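(* Let $k\ge 5$ be an integer, let $n=4k+2$, let $G$ be a cyclic group of order $n$ (written additively), and let $g\in G$ with $\operatorname{ord}(g)=n$. Then the sequence \[ S = g^{\frac{n}{2}-3}\cdot \left(\tfrac{n}{2} g \right)\cdot \left( \big(\tfrac{n}{2}+1\big) g \right)^{\frac{n}{2}-1}\cdot \left( \big(\tfrac{n}{2}+2 \big) g \right)^{\lfloor\frac{n}{4}\rfloor-2} \] over $G$ has no subsequence $T$ with $\operatorname{ind}(T)=1$.
   Context: A sequence over $G$ is a finite unordered sequence of elements of $G$ with repetition allowed (a finite multiset, i.e. an element of the free abelian monoid with basis $G$), written multiplicatively; exponents denote multiplicities. A subsequence is a sub-multiset. For a sequence $T$ over the cyclic group $G$ of order $n$ and $h\in G$ with $\operatorname{ord}(h)=n$, write $T=(n_1h)\cdot\ldots\cdot(n_lh)$ with integers $n_1,\ldots,n_l\in[1,n]$ and put $\|T\|_h=\frac{n_1+\cdots+n_l}{n}$. The index of $T$ is $\operatorname{ind}(T)=\min\{\|T\|_h : h\in G,\ \operatorname{ord}(h)=n\}$. *)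

theory Defs
  imports "HOL-Algebra.Multiplicative_Group" "HOL-Algebra.Elementary_Groups" "HOL-Library.Multiset"
begin

text \<open>
  Groups are written multiplicatively, as everywhere in HOL-Algebra: the multiple \<open>m h\<close> of the
  additive notation is \<open>h [^] m\<close>. A sequence over \<open>G\<close> is a multiset over the carrier of \<open>G\<close>, and
  a subsequence is a submultiset.
\<close>

definition coord :: "('a, 'b) monoid_scheme \<Rightarrow> 'a \<Rightarrow> 'a \<Rightarrow> nat" where
  "coord G h x = (THE m. m \<in> {1..order G} \<and> h [^]\<^bsub>G\<^esub> m = x)"
  \<comment> \<open>meant for \<open>h\<close> of order \<open>order G\<close>; the range starts at 1, so the neutral element has
     coordinate \<open>order G\<close>, not 0\<close>

definition seq_norm :: "('a, 'b) monoid_scheme \<Rightarrow> 'a \<Rightarrow> 'a multiset \<Rightarrow> real" where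
  "seq_norm G h T = real (\<Sum>x\<in>#T. coord G h x) / real (order G)"

definition seq_index :: "('a, 'b) monoid_scheme \<Rightarrow> 'a multiset \<Rightarrow> real" where
  "seq_index G T = Min {seq_norm G h T | h. h \<in> carrier G \<and> group.ord G h = order G}"

lemma (in group) coord_pow:
  assumes "h \<in> carrier G" "ord h = order G" "m \<in> {1..order G}"
  shows "coord G h (h [^] m) = m"
  unfolding coord_def
  using assms inj_onD[OF ord_inj'[OF assms(1)]] by (intro the_equality) auto

text \<open>The norm is computed from any representation of \<open>T\<close> by integers in \<open>[1, n]\<close>.\<close>

lemma (in group) seq_norm_image_pow:
  assumes "h \<in> carrier G" "ord h = order G" "set_mset N \<subseteq> {1..order G}"
  shows "seq_norm G h (image_mset (\<lambda>m. h [^] m) N) = real (sum_mset N) / real (order G)"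
proof -
  have "image_mset (\<lambda>m. coord G h (h [^] m)) N = image_mset (\<lambda>m. m) N"
    using assms coord_pow by (intro image_mset_cong) blast
  then show ?thesis
    by (simp add: seq_norm_def multiset.map_comp o_def)
qed

lemma (in group) seq_index_attained:
  assumes "finite (carrier G)" "g \<in> carrier G" "ord g = order G"
  obtains h where "h \<in> carrier G" "ord h = order G" "seq_index G T = seq_norm G h T"
    and "\<And>h'. h' \<in> carrier G \<Longrightarrow> ord h' = order G \<Longrightarrow> seq_index G T \<le> seq_norm G h' T"
proof -
  let ?A = "{seq_norm G h T | h. h \<in> carrier G \<and> ord h = order G}"
  have fin: "finite ?A" and ne: "?A \<noteq> {}"
    using assms by auto
  show thesis
    using Min_in[OF fin ne] Min_le[OF fin] that unfolding seq_index_def by blast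
qed

end

theory Submission
  imports Defs
begin

text \<open>
  Let \<open>m = n div 2 = 2 k + 1\<close>, which is odd. A subsequence \<open>T\<close> consists of \<open>a\<close>, \<open>b\<close>, \<open>c\<close>, \<open>d\<close>
  copies of \<open>g\<close>, \<open>m g\<close>, \<open>(m + 1) g\<close>, \<open>(m + 2) g\<close> (additive notation). If \<open>ind(T) = 1\<close>, then
  some generator \<open>h\<close> makes the coordinates of \<open>T\<close> add up to exactly \<open>n\<close>. Write \<open>g = u h\<close>. As \<open>g\<close> and \<open>h\<close> are both generators, \<open>u\<close> is
  coprime to \<open>n = 2 m\<close>, so it is odd and its representative nearest to zero has \<open>\<bar>u\<bar> < m\<close>.
  The oddness of \<open>u\<close> gives \<open>u m \<equiv> m\<close>, so the four elements have coordinates congruent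
  to \<open>u\<close>, \<open>m\<close>, \<open>m + u\<close> and \<open>m + 2 u\<close> modulo \<open>2 m\<close>. The second and third of these always lie in
  the range from \<open>1\<close> to \<open>n\<close>; the first needs a correction by \<open>2 m\<close> for \<open>u < 0\<close>, the last one for
  \<open>\<bar>u\<bar> > m / 2\<close>.

  Modulo \<open>m\<close>, the sum of the coordinates is \<open>u (a + c + 2 d)\<close>, and \<open>u\<close> is invertible, so
  \<open>a + c + 2 d = m q\<close>. Dividing the equation "sum \<open>= 2 m\<close>" by \<open>m\<close> leaves a small linear equation
  between \<open>a\<close>, \<open>b\<close>, \<open>c\<close>, \<open>d\<close> and \<open>q\<close>. In each of the four ranges of \<open>u\<close> it contradicts the
  multiplicities in \<open>S\<close>: either it needs more than \<open>k - 2\<close> copies of \<open>(m + 2) g\<close>, or it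
  forces nearly all of \<open>T\<close> into copies of \<open>g\<close> alone or of \<open>(m + 1) g\<close> alone, of which there
  are too few.
\<close>

section \<open>The arithmetic of the coordinates\<close>

text \<open>
  The summands are the least positive residues modulo \<open>2 m\<close> of \<open>u\<close>, \<open>m\<close>, \<open>m + u\<close> and
  \<open>m + 2 u\<close>, taken \<open>a\<close>, \<open>b\<close>, \<open>c\<close> and \<open>d\<close> times. For negative \<open>u\<close> it pays to subtract the
  relation \<open>a + c + 2 d = m q\<close> from the equation divided by \<open>m\<close>: this replaces \<open>u q\<close> by
  \<open>(m + u) q\<close>, whose factors are both positive.
\<close>

lemma residue_sum_neq:
  fixes k m u a b c d :: int
  assumes m: "m = 2 * k + 1" and k: "k \<ge> 2"
    and u: "odd u" "coprime u m" "- m < u" "u < m"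
    and a: "0 \<le> a" "a \<le> m - 3" and b: "0 \<le> b" "b \<le> 1"
    and c: "0 \<le> c" "c \<le> m - 1" and d: "0 \<le> d" "d \<le> k - 2"
  shows "a * (if u < 0 then u + 2 * m else u) + b * m + c * (m + u)
       + d * (if m < 2 * u then 2 * u - m else if 2 * u < - m then 2 * u + 3 * m else 2 * u + m)
       \<noteq> 2 * m" (is "?sum \<noteq> _")
proof
  assume sum: "?sum = 2 * m"
  define e where "e = (if m < 2 * u then - 1 else if 2 * u < - m then 1 else 0 :: int)"
  define f where "f = (if u < 0 then 2 else 0 :: int)"
  have "?sum = u * (a + c + 2 * d) + m * (f * a + b + c + (2 * e + 1) * d)"
    by (simp add: e_def f_def algebra_simps)
  with sum have eq: "u * (a + c + 2 * d) = m * (2 - (f * a + b + c + (2 * e + 1) * d))"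
    by (simp add: algebra_simps)
  then have "m dvd u * (a + c + 2 * d)"
    by simp
  then have "m dvd a + c + 2 * d"
    using u(2) by (simp add: coprime_dvd_mult_right_iff coprime_commute)
  then obtain q where q: "a + c + 2 * d = m * q" ..
  have m0: "m > 0" using m k by simp
  have "m * (u * q) = m * (2 - (f * a + b + c + (2 * e + 1) * d))"
    using eq q by (simp add: ac_simps)
  then have red: "u * q + f * a + b + c + (2 * e + 1) * d = 2"
    using m0 by simp
  have "0 \<le> m * q"
    using a c d by (simp flip: q)
  then have "q \<ge> 0"
    using m0 by (simp add: zero_le_mult_iff)
  moreover have "q \<noteq> 0"
  proof
    assume "q = 0"
    then have "a = 0" "c = 0" "d = 0" using q a c d by auto
    then show False using red b \<open>q = 0\<close> by simp
  qed
  ultimately have q1: "q \<ge> 1" by simp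
  then have mq: "m \<le> m * q" using m0 by simp
  have "u \<noteq> 0" "2 * u \<noteq> m" "2 * u \<noteq> - m"
    using u(1) m by presburger+
  then have "(0 < u \<and> 2 * u < m) \<or> m < 2 * u \<or> (u < 0 \<and> - m < 2 * u) \<or> 2 * u < - m"
    by linarith
  then consider "0 < u" "2 * u < m" | "m < 2 * u" | "u < 0" "- m < 2 * u" | "2 * u < - m"
    by blast
  then show False
  proof cases
    case 1
    \<comment> \<open>At most one element other than \<open>g\<close> fits, which leaves too much for the copies of \<open>g\<close>.\<close>
    then have "e = 0" "f = 0" by (auto simp: e_def f_def)
    with red have *: "u * q + b + c + d = 2" by simp
    have "1 \<le> u * q" using 1 q1 by (simp add: int_one_le_iff_zero_less)
    then show False using * q mq a b c d by linarith
  next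
    case 2
    \<comment> \<open>Only copies of \<open>(m + 2) g\<close>, of coordinate \<open>2 u - m < u\<close>, can balance the term
       \<open>u q\<close>, and they would have to number at least \<open>u - 2 \<ge> k - 1\<close>.\<close>
    then have "e = - 1" "f = 0" using m0 by (auto simp: e_def f_def)
    with red have *: "u * q + b + c - d = 2" by simp
    have "u \<le> u * q" using 2 m0 q1 by simp
    then show False using * 2 b c d m by linarith
  next
    case 3
    then have "e = 0" "f = 2" using m0 by (auto simp: e_def f_def)
    with red q have *: "(m + u) * q + a + b - d = 2" by (simp add: algebra_simps)
    have "m + u \<le> (m + u) * q" using u q1 by simp
    then show False using * 3 a b d m by linarith
  next
    case 4
    \<comment> \<open>As \<open>m + u\<close> is even and positive, it is at least 2, which leaves no room for anything
       but \<open>m\<close> copies of \<open>(m + 1) g\<close>.\<close>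
    then have "e = 1" "f = 2" using m0 by (auto simp: e_def f_def)
    with red q have *: "(m + u) * q + a + b + d = 2" by (simp add: algebra_simps)
    have "even (m + u)" using u(1) m by simp
    then have mu: "2 \<le> m + u" using u(3) by presburger
    have "m + u \<le> (m + u) * q" using u q1 by simp
    with * mu a b d have "a = 0" "d = 0" by linarith+
    then show False using q mq c by linarith
  qed
qed

section \<open>Generators and coordinates\<close>

lemma (in group) generator_power_of_generator:
  assumes "finite (carrier G)" "g \<in> carrier G" "h \<in> carrier G"
    and "ord g = order G" "ord h = order G"
  obtains i :: int where "g = h [^] i" "coprime i (int (order G))"
proof -
  have gen: "\<exists>i::int. y = x [^] i"
    if "x \<in> carrier G" "ord x = order G" "y \<in> carrier G" for x y
  proof -
    have "generate G {x} \<subseteq> carrier G"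
      using that by (simp add: generate_incl)
    moreover have "card (generate G {x}) = card (carrier G)"
      using that generate_pow_card[of x] by (simp add: order_def)
    ultimately have "generate G {x} = carrier G"
      using assms(1) by (simp add: card_subset_eq)
    then show ?thesis
      using that generate_pow[of x] by auto
  qed
  obtain i j :: int where i: "g = h [^] i" and j: "h = g [^] j"
    using gen assms by meson
  have "h [^] (i * j) = h [^] (1::int)"
    using i j assms(3) by (simp add: int_pow_pow[symmetric])
  then have unit: "int (order G) dvd 1 - i * j"
    using int_pow_eq[OF assms(3)] assms(5) by simp
  have "coprime i (int (order G))"
  proof (rule coprimeI)
    fix l assume "l dvd i" "l dvd int (order G)"
    with unit have "l dvd 1 - i * j" "l dvd i * j"
      by (auto intro: dvd_trans)
    then show "is_unit l"
      using dvd_add by fastforce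
  qed
  with i that show thesis by blast
qed

lemma (in group) coord_pow_int_pow:
  assumes "h \<in> carrier G" "ord h = order G" "w \<in> {1..int (order G)}"
    and "int (order G) dvd w - u * int j"
  shows "int (coord G h ((h [^] u) [^] j)) = w"
proof -
  have "(h [^] u) [^] j = h [^] (u * int j)"
    using assms(1) by (simp add: int_pow_pow int_pow_int[symmetric])
  also have "\<dots> = h [^] w"
    using assms by (simp add: int_pow_eq)
  also have "\<dots> = h [^] nat w"
    using assms(3) by (simp add: int_pow_int[symmetric])
  finally have "(h [^] u) [^] j = h [^] nat w" .
  moreover have "nat w \<in> {1..order G}"
    using assms(3) by auto
  then have "coord G h (h [^] nat w) = nat w"
    by (rule coord_pow[OF assms(1,2)])
  ultimately show ?thesis
    using assms(3) by (simp only: atLeastAtMost_iff int_nat_eq) simp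
qed

section \<open>Subsequences and the conclusion\<close>

lemma subseteq_mset_plusE:
  assumes "T \<subseteq># A + B"
  obtains A' B' where "T = A' + B'" "A' \<subseteq># A" "B' \<subseteq># B"
proof
  show "T = T \<inter># A + (T - A)"
    by (metis add.commute diff_intersect_left_idem subset_mset.diff_add subset_mset.inf_le1)
  show "T - A \<subseteq># B"
    using assms by (simp add: subset_eq_diff_conv add.commute)
qed simp

theorem theorem1p2:
  fixes G (structure) and k n :: nat and g :: 'a and S :: "'a multiset"
  assumes "k \<ge> 5" and "n = 4 * k + 2"
    and "group G" and "cyclic_group G" and "order G = n"
    and "g \<in> carrier G" and "group.ord G g = n"
    and "S = replicate_mset (n div 2 - 3) g
           + {# g [^] (n div 2) #}
           + replicate_mset (n div 2 - 1) (g [^] (n div 2 + 1))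
           + replicate_mset (n div 4 - 2) (g [^] (n div 2 + 2))"
  shows "\<not> (\<exists>T. T \<subseteq># S \<and> seq_index G T = 1)"
proof
  assume "\<exists>T. T \<subseteq># S \<and> seq_index G T = 1"
  then obtain T where T: "T \<subseteq># S" and ind: "seq_index G T = 1" by blast
  interpret group G by fact
  define m where "m = 2 * int k + 1"
  have n: "int n = 2 * m" and m0: "m > 0" and half: "int (n div 2) = m"
    using assms(2) by (auto simp: m_def)
  have fin: "finite (carrier G)"
    using assms(2,5) order_gt_0_iff_finite by simp
  have ordg: "ord g = order G" using assms by simp
  obtain h where h: "h \<in> carrier G" "ord h = order G" and norm: "seq_norm G h T = 1"
    using seq_index_attained[OF fin assms(6) ordg] ind by metis
  obtain i where i: "g = h [^] i" "coprime i (int n)"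
    using generator_power_of_generator[OF fin assms(6) h(1) ordg h(2)] assms(5) by metis

  \<comment> \<open>The representative of \<open>i\<close> modulo \<open>2 m\<close> in the range from \<open>- m\<close> to \<open>m - 1\<close>; being
     coprime to \<open>m > 1\<close>, it is not \<open>- m\<close> itself.\<close>
  define u where "u = (i + m) mod (2 * m) - m"
  have iu: "2 * m dvd u - i"
  proof -
    have "2 * m dvd (i + m) mod (2 * m) - (i + m)"
      by (metis dvd_diff_commute dvd_minus_mod)
    then show ?thesis by (simp add: u_def algebra_simps)
  qed
  have gu: "g = h [^] u"
    using i(1) h iu n assms(5) by (simp add: int_pow_eq)
  have "coprime u (2 * m)"
  proof (rule coprimeI)
    fix l assume l: "l dvd u" "l dvd 2 * m"
    then have "l dvd i"
      using iu by (meson dvd_diff_right_iff dvd_trans)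
    then show "is_unit l"
      using i(2) l(2) n by (metis coprime_common_divisor)
  qed
  then have odd: "odd u" and cop: "coprime u m"
    by (auto simp: coprime_commute)
  have "u \<noteq> - m"
  proof
    assume "u = - m"
    then have "is_unit m" using cop by simp
    then show False using assms(1) by (simp add: m_def)
  qed
  moreover have "- m \<le> u" "u < m"
    using m0 pos_mod_bound[of "2 * m" "i + m"] pos_mod_sign[of "2 * m" "i + m"]
    by (auto simp: u_def)
  ultimately have u: "- m < u" "u < m" by auto

  obtain a b c d where abcd: "a \<le> n div 2 - 3" "b \<le> 1" "c \<le> n div 2 - 1" "d \<le> n div 4 - 2"
    and Teq: "T = replicate_mset a g + replicate_mset b (g [^] (n div 2))
       + replicate_mset c (g [^] (n div 2 + 1)) + replicate_mset d (g [^] (n div 2 + 2))"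
  proof -
    have "T \<subseteq># replicate_mset (n div 2 - 3) g + replicate_mset 1 (g [^] (n div 2))
       + replicate_mset (n div 2 - 1) (g [^] (n div 2 + 1))
       + replicate_mset (n div 4 - 2) (g [^] (n div 2 + 2))"
      using T assms(8) by simp
    then show thesis
      by (elim subseteq_mset_plusE msubseteq_replicate_msetE) (use that in blast)
  qed

  have coord: "int (coord G h (g [^] j)) = w"
    if "1 \<le> w" "w \<le> 2 * m" "2 * m dvd w - u * int j" for w j
    using coord_pow_int_pow[OF h, of w u j] that n assms(5) gu by simp
  obtain v where v: "u = 2 * v + 1" using odd by (elim oddE)
  have w0: "int (coord G h g) = (if u < 0 then u + 2 * m else u)"
  proof -
    have "u \<noteq> 0" using odd by auto
    then show ?thesis
      using coord[of "if u < 0 then u + 2 * m else u" 1] u assms(6) by auto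
  qed
  have wm: "int (coord G h (g [^] (n div 2))) = m"
  proof (rule coord)
    have "m - u * m = 2 * m * (- v)" by (simp add: v algebra_simps)
    then show "2 * m dvd m - u * int (n div 2)" unfolding half by simp
  qed (use m0 in auto)
  have w1: "int (coord G h (g [^] (n div 2 + 1))) = m + u"
  proof (rule coord)
    have "m + u - u * (m + 1) = 2 * m * (- v)" by (simp add: v algebra_simps)
    then show "2 * m dvd m + u - u * int (n div 2 + 1)" unfolding of_nat_add half by simp
  qed (use u in auto)
  have w2: "int (coord G h (g [^] (n div 2 + 2)))
      = (if m < 2 * u then 2 * u - m else if 2 * u < - m then 2 * u + 3 * m else 2 * u + m)"
    (is "_ = ?w")
  proof (rule coord)
    \<comment> \<open>The boundary case \<open>2 u = - m\<close> would give residue 0 instead of \<open>2 m\<close>; \<open>m\<close> is odd.\<close>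
    have "2 * u \<noteq> - m" unfolding m_def by presburger
    then show "1 \<le> ?w" "?w \<le> 2 * m" using u by auto
    have "?w - u * (m + 2) =
        2 * m * ((if m < 2 * u then - 1 else if 2 * u < - m then 1 else 0) - v)"
      by (simp add: v algebra_simps)
    then show "2 * m dvd ?w - u * int (n div 2 + 2)"
      unfolding of_nat_add half by (metis dvd_triv_left of_nat_numeral)
  qed

  have "real (\<Sum>x\<in>#T. coord G h x) = real n"
    using norm assms(2,5) by (simp add: seq_norm_def field_simps)
  then have "int (\<Sum>x\<in>#T. coord G h x) = 2 * m"
    using n by linarith
  then have "int a * int (coord G h g) + int b * int (coord G h (g [^] (n div 2)))
      + int c * int (coord G h (g [^] (n div 2 + 1)))
      + int d * int (coord G h (g [^] (n div 2 + 2))) = 2 * m"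
    by (simp add: Teq)
  then have "int a * (if u < 0 then u + 2 * m else u) + int b * m + int c * (m + u)
      + int d * (if m < 2 * u then 2 * u - m else if 2 * u < - m then 2 * u + 3 * m else 2 * u + m)
      = 2 * m"
    by (simp only: w0 wm w1 w2)
  moreover have "int a \<le> m - 3" "int b \<le> 1" "int c \<le> m - 1" "int d \<le> int k - 2" "int k \<ge> 2"
    using abcd assms(1,2) by (auto simp: m_def)
  ultimately show False
    using residue_sum_neq[OF m_def _ odd cop u of_nat_0_le_iff _ of_nat_0_le_iff _
        of_nat_0_le_iff _ of_nat_0_le_iff] by blast
qed

end
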